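(* Let $d\ge1$, $\alpha\in(0,2)$, and let $V:\mathbb{R}^d\to\mathbb{R}$ be a locally bounded Borel measurable function with $e^{-V}\in L^1(dx)$. There exists a constant $C_4>0$ such that for any $r>3$ and $f\in C_b^\infty(\mathbb{R}^d)$, $$\begin{aligned}\int_{B(0,r)}&\bigg(f(x)-\frac{\int_{B(0,r)}f\,d\mu_V}{\mu_V(B(0,r))}\bigg)^2\mu_V(dx)\\&\le\frac{C_4K(r)r^{2d+\alpha}}{k(r)}\iint_{B(0,r+1)\times B(0,r+1)}\frac{(f(x)-f(y))^2}{|x-y|^{d+\alpha}}\mathbf{1}_{\{|x-y|>1\}}\,dy\,\mu_V(dx)\\&\le\frac{2C_4K(r)r^{2d+\alpha}}{k(r)}\,\mathscr{D}_{\alpha,V}(f,f).\end{aligned}$$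
   Context: $C_b^\infty(\mathbb{R}^d)$ is the set of smooth functions with bounded derivatives of every order (including order $0$). $B(x,r)$ is the ball with center $x$ and radius $r$. $\mu_V(dx)=C_Ve^{-V(x)}\,dx$ with $C_V=\big(\int e^{-V(x)}dx\big)^{-1}$ is a probability measure. For $r>0$, $k(r):=\inf_{|x|\le r+1}e^{-V(x)}$ and $K(r):=\sup_{|x|\le r}e^{-V(x)}$. The form is $$\mathscr{D}_{\alpha,V}(f,f):=\frac12\iint_{\{|x-y|>1\}}\frac{(f(x)-f(y))^2}{|x-y|^{d+\alpha}}\,dy\,\mu_V(dx).$$ *)

theory Defs
  imports "HOL-Analysis.Analysis"
begin

text \<open>
  The space $R^d$ is an arbitrary type of class \<^class>\<open>euclidean_space\<close>, with
  $d = $ \<open>DIM('a)\<close>, which is automatically at least 1.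
\<close>

primrec iter_partial :: "'a list \<Rightarrow> ('a::euclidean_space \<Rightarrow> real) \<Rightarrow> 'a \<Rightarrow> real" where
  "iter_partial [] f = f"
| "iter_partial (b # bs) f = (\<lambda>x. frechet_derivative (iter_partial bs f) (at x) b)"

text \<open>
  A function is smooth iff all its iterated partial derivatives exist and are (totally)
  differentiable. The empty list gives the requirement of order 0.
\<close>

definition Cb_infty :: "('a::euclidean_space \<Rightarrow> real) set" where
  "Cb_infty = {f. \<forall>bs. set bs \<subseteq> Basis \<longrightarrow>
      (\<forall>x. iter_partial bs f differentiable (at x)) \<and> bounded (range (iter_partial bs f))}"

definition locally_bounded :: "('a::euclidean_space \<Rightarrow> real) \<Rightarrow> bool" where
  "locally_bounded V \<longleftrightarrow> (\<forall>x. \<exists>U. open U \<and> x \<in> U \<and> bounded (V ` U))"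

definition C_norm :: "('a::euclidean_space \<Rightarrow> real) \<Rightarrow> real" where
  "C_norm V = inverse (\<integral>x. exp (- V x) \<partial>lborel)"

definition mu :: "('a::euclidean_space \<Rightarrow> real) \<Rightarrow> 'a measure" where
  "mu V = density lborel (\<lambda>x. ennreal (C_norm V * exp (- V x)))"

text \<open>
  These are conditionally complete infima and suprema in the reals. They have their usual meaning
  for \<open>r \<ge> 0\<close> (nonempty balls) and locally bounded \<open>V\<close>, the latter making \<open>exp (- V x)\<close> bounded
  on the ball.
\<close>

definition k_inf :: "('a::euclidean_space \<Rightarrow> real) \<Rightarrow> real \<Rightarrow> real" where
  "k_inf V r = (INF x\<in>cball 0 (r + 1). exp (- V x))"

definition K_sup :: "('a::euclidean_space \<Rightarrow> real) \<Rightarrow> real \<Rightarrow> real" where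
  "K_sup V r = (SUP x\<in>cball 0 r. exp (- V x))"

definition jump_density :: "real \<Rightarrow> ('a::euclidean_space \<Rightarrow> real) \<Rightarrow> 'a \<Rightarrow> 'a \<Rightarrow> real" where
  "jump_density \<alpha> f x y = (f x - f y)\<^sup>2 / norm (x - y) powr (real DIM('a) + \<alpha>)"

text \<open>
  Integrals of nonnegative functions are taken in $[0,\infty]$, so that no integrability
  condition is hidden in their values.
\<close>

definition D_form :: "real \<Rightarrow> ('a::euclidean_space \<Rightarrow> real) \<Rightarrow> ('a \<Rightarrow> real) \<Rightarrow> ennreal" where
  "D_form \<alpha> V f =
     (1 / 2) * (\<integral>\<^sup>+x. (\<integral>\<^sup>+y\<in>{y. norm (x - y) > 1}. ennreal (jump_density \<alpha> f x y) \<partial>lborel) \<partial>mu V)"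

end

theory Submission
  imports Defs
begin

text \<open>
  Choose two balls of radius 1/2 centred at \<open>p\<close> and \<open>-p\<close> with \<open>norm p = 2\<close>. No point is within
  distance 1 of both, so \<open>f x\<close> can always be compared, using jumps longer than 1 only, with
  the Lebesgue average of \<open>f\<close> over one of them. The variance is at most the mean square deviation
  from the average over the first ball; at the points \<open>x\<close> near that ball one passes through the
  second average. The difference of the two averages is itself estimated by the energy of the points
  of the first ball. The change from Lebesgue measure to the measure \<open>mu V\<close> there and back is the only
  place where the factor \<open>K_sup V r / k_inf V r\<close> is lost.
\<close>

section \<open>Extended-real arithmetic and the variance identity\<close>

lemma ennreal_le_divide_if_mult_le:
  fixes X Y :: ennreal
  assumes "0 < a" "0 \<le> b" "ennreal a * X \<le> ennreal b * Y"
  shows "X \<le> ennreal (b / a) * Y"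
proof -
  have "X = ennreal (1 / a) * (ennreal a * X)"
    using assms(1) by (simp add: mult.assoc[symmetric] ennreal_mult[symmetric])
  also have "\<dots> \<le> ennreal (1 / a) * (ennreal b * Y)"
    using assms(3) by (rule mult_left_mono) simp
  also have "\<dots> = ennreal (b / a) * Y"
    using assms(1,2) by (simp add: mult.assoc[symmetric] ennreal_mult[symmetric])
  finally show ?thesis .
qed

lemma set_integrable_bounded:
  fixes f :: "'a \<Rightarrow> real"
  assumes "f \<in> borel_measurable M" "A \<in> sets M" "emeasure M A < \<infinity>" "bounded (range f)"
  shows "set_integrable M A f"
proof -
  obtain b where "\<And>x. norm (f x) \<le> b"
    using assms(4) by (auto simp: bounded_iff)
  then show ?thesis
    unfolding set_integrable_def
    using assms(1-3) by (intro integrableI_bounded_set_indicator[where B=b]) auto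
qed

text \<open>The cross term vanishes because \<open>f - c\<close> has mean zero over
  \<open>A\<close>. Dropping one summand on the right gives two facts: the mean \<open>c\<close>
  minimises the mean square deviation, and (Jensen) the squared deviation of the mean from
  \<open>t\<close> is at most the mean square deviation of \<open>f\<close> from \<open>t\<close>.
  Boundedness on a set of finite measure keeps all integrals finite, so real subtraction is
  available.\<close>

lemma set_nn_integral_square_shift:
  fixes f :: "'a \<Rightarrow> real" and t :: real
  assumes f: "f \<in> borel_measurable M" "bounded (range f)"
    and A: "A \<in> sets M" "emeasure M A < \<infinity>" "0 < measure M A"
  defines "c \<equiv> (LINT z:A|M. f z) / measure M A"
  shows "(\<integral>\<^sup>+x\<in>A. ennreal ((f x - t)\<^sup>2) \<partial>M)
    = (\<integral>\<^sup>+x\<in>A. ennreal ((f x - c)\<^sup>2) \<partial>M) + ennreal (measure M A * (c - t)\<^sup>2)"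
proof -
  have sq_integrable: "set_integrable M A (\<lambda>x. (f x - s)\<^sup>2)" for s
  proof -
    obtain b where "\<And>x. \<bar>f x\<bar> \<le> b"
      using f(2) by (auto simp: bounded_iff)
    then have "\<bar>f x - s\<bar> \<le> b + \<bar>s\<bar>" for x
      using abs_triangle_ineq4[of "f x" s] by (meson add_right_mono order_trans)
    then have "(f x - s)\<^sup>2 \<le> (b + \<bar>s\<bar>)\<^sup>2" for x
      using power_mono[of "\<bar>f x - s\<bar>" "b + \<bar>s\<bar>" 2] by simp
    then have "bounded (range (\<lambda>x. (f x - s)\<^sup>2))"
      by (auto simp: bounded_iff)
    then show ?thesis
      using f(1) A by (intro set_integrable_bounded) auto
  qed
  have nn: "(\<integral>\<^sup>+x\<in>A. ennreal ((f x - s)\<^sup>2) \<partial>M) = ennreal (LINT x:A|M. (f x - s)\<^sup>2)" for s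
  proof -
    have "(\<integral>\<^sup>+x\<in>A. ennreal ((f x - s)\<^sup>2) \<partial>M)
        = (\<integral>\<^sup>+x. ennreal (indicator A x *\<^sub>R (f x - s)\<^sup>2) \<partial>M)"
      by (intro nn_integral_cong) (auto split: split_indicator)
    also have "\<dots> = ennreal (LINT x:A|M. (f x - s)\<^sup>2)"
      unfolding set_lebesgue_integral_def
      using sq_integrable by (intro nn_integral_eq_integral) (auto simp: set_integrable_def)
    finally show ?thesis .
  qed
  have f_int: "set_integrable M A f"
    using f A by (intro set_integrable_bounded)
  have const_int: "set_integrable M A (\<lambda>x. s)" for s :: real
    using A by (intro set_integrable_bounded) auto
  have mean: "(LINT z:A|M. f z) = c * measure M A"
    using A by (simp add: c_def)
  \<comment> \<open>The square is expanded around \<open>c\<close> so that the remainder is affine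
    in \<open>f\<close>; its integral is then known from \<open>mean\<close>.\<close>
  have "(LINT x:A|M. (f x - t)\<^sup>2)
      = (LINT x:A|M. (f x - c)\<^sup>2 + (2 * (c - t) * f x + (t\<^sup>2 - c\<^sup>2)))"
    by (intro arg_cong[where f="set_lebesgue_integral M A"] ext)
      (simp add: power2_eq_square algebra_simps)
  also have "\<dots> = (LINT x:A|M. (f x - c)\<^sup>2) + (2 * (c - t) * (c * measure M A)
      + measure M A * (t\<^sup>2 - c\<^sup>2))"
    using A const_int f_int sq_integrable mean
    by (simp add: set_integral_const del: set_integral_diff)
  also have "\<dots> = (LINT x:A|M. (f x - c)\<^sup>2) + measure M A * (c - t)\<^sup>2"
    by (simp add: power2_eq_square algebra_simps)
  finally have "(LINT x:A|M. (f x - t)\<^sup>2)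
      = (LINT x:A|M. (f x - c)\<^sup>2) + measure M A * (c - t)\<^sup>2" .
  moreover have "0 \<le> (LINT x:A|M. (f x - c)\<^sup>2)"
    unfolding set_lebesgue_integral_def by (intro integral_nonneg_AE) auto
  ultimately show ?thesis
    by (simp add: nn ennreal_plus)
qed

section \<open>Bounds on the weight and comparison of \<open>mu V\<close> with Lebesgue
  measure\<close>

lemma locally_bounded_bounded_on_compact:
  assumes "locally_bounded V" "compact S"
  shows "bounded (V ` S)"
proof -
  obtain U where U: "\<And>x. open (U x)" "\<And>x. x \<in> U x" "\<And>x. bounded (V ` U x)"
    using assms(1) unfolding locally_bounded_def by metis
  have cover: "S \<subseteq> (\<Union>x\<in>S. U x)"
    using U(2) by blast
  obtain T where T: "T \<subseteq> S" "finite T" "S \<subseteq> (\<Union>x\<in>T. U x)"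
    by (rule compactE_image[OF assms(2) U(1) cover])
  from T(2) have "bounded (\<Union>x\<in>T. V ` U x)"
    by (rule bounded_UN) (simp add: U(3))
  moreover have "V ` S \<subseteq> (\<Union>x\<in>T. V ` U x)"
    using T(3) by blast
  ultimately show ?thesis
    by (rule bounded_subset)
qed

text \<open>Closed balls are compact, so \<open>V\<close> is bounded on them; the infimum and
  supremum thus range over bounded sets of reals and are genuine. The origin, lying in both balls,
  links the two.\<close>

lemma
  assumes "locally_bounded V" "0 \<le> r"
  shows k_inf_pos: "0 < k_inf V r"
    and k_inf_le: "x \<in> cball 0 (r + 1) \<Longrightarrow> k_inf V r \<le> exp (- V x)"
    and le_K_sup: "x \<in> cball 0 r \<Longrightarrow> exp (- V x) \<le> K_sup V r"
    and k_inf_le_K_sup: "k_inf V r \<le> K_sup V r"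
proof -
  have "bounded (V ` cball 0 (r + 1))"
    using assms(1) by (intro locally_bounded_bounded_on_compact) auto
  then obtain b where b: "\<And>x. x \<in> cball 0 (r + 1) \<Longrightarrow> \<bar>V x\<bar> \<le> b"
    by (metis bounded_iff imageI real_norm_def)
  have lower: "exp (- b) \<le> exp (- V x)" if "x \<in> cball 0 (r + 1)" for x
    using b[OF that] by simp
  have upper: "exp (- V x) \<le> exp b" if "x \<in> cball 0 r" for x
    using b[of x] that by simp
  have "exp (- b) \<le> k_inf V r"
    unfolding k_inf_def using lower assms(2) by (intro cINF_greatest) auto
  then show "0 < k_inf V r"
    using exp_gt_zero[of "- b"] by linarith
  show k: "k_inf V r \<le> exp (- V x)" if "x \<in> cball 0 (r + 1)" for x
    unfolding k_inf_def using that lower by (intro cINF_lower bdd_belowI2[where m="exp (- b)"])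
  show K: "exp (- V x) \<le> K_sup V r" if "x \<in> cball 0 r" for x
    unfolding K_sup_def using that upper by (intro cSUP_upper bdd_aboveI2[where M="exp b"])
  show "k_inf V r \<le> K_sup V r"
    using k[of 0] K[of 0] assms(2) by simp
qed

text \<open>A strictly positive function with zero integral would force Lebesgue measure to be null.
  This rules out the value \<open>inverse 0 = 0\<close>.\<close>

lemma C_norm_pos:
  fixes V :: "'a::euclidean_space \<Rightarrow> real"
  assumes "integrable lborel (\<lambda>x. exp (- V x))"
  shows "0 < C_norm V"
proof -
  have "(\<integral>x. exp (- V x) \<partial>lborel) \<noteq> 0"
  proof
    assume "(\<integral>x. exp (- V x) \<partial>lborel) = 0"
    then have "AE x in lborel. exp (- V x) = 0"
      using integral_nonneg_eq_0_iff_AE[OF assms] by simp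
    then have "AE x::'a in lborel. False"
      by (auto elim: eventually_mono)
    then show False
      by (simp add: eventually_False ae_filter_eq_bot_iff)
  qed
  moreover have "0 \<le> (\<integral>x. exp (- V x) \<partial>lborel)"
    by (intro integral_nonneg_AE) simp
  ultimately show ?thesis
    unfolding C_norm_def by (intro positive_imp_inverse_positive) linarith
qed

lemma sets_mu [simp, measurable_cong]: "sets (mu V) = sets borel"
  by (simp add: mu_def)

lemma set_nn_integral_mu:
  assumes [measurable]: "V \<in> borel_measurable borel" "g \<in> borel_measurable borel" "S \<in> sets borel"
  shows "(\<integral>\<^sup>+x\<in>S. g x \<partial>mu V)
    = (\<integral>\<^sup>+x\<in>S. ennreal (C_norm V * exp (- V x)) * g x \<partial>lborel)"
  unfolding mu_def by (subst nn_integral_density) (auto simp: mult.assoc)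

lemma set_nn_integral_mu_lower:
  assumes meas: "V \<in> borel_measurable borel" "g \<in> borel_measurable borel" "S \<in> sets borel"
    and c: "0 \<le> C_norm V" "\<And>x. x \<in> S \<Longrightarrow> c \<le> exp (- V x)"
  shows "ennreal (C_norm V * c) * (\<integral>\<^sup>+x\<in>S. g x \<partial>lborel) \<le> (\<integral>\<^sup>+x\<in>S. g x \<partial>mu V)"
proof -
  note [measurable] = meas
  have "ennreal (C_norm V * c) * (\<integral>\<^sup>+x\<in>S. g x \<partial>lborel)
      = (\<integral>\<^sup>+x. ennreal (C_norm V * c) * (g x * indicator S x) \<partial>lborel)"
    by (intro nn_integral_cmult[symmetric]) simp
  also have "\<dots> \<le> (\<integral>\<^sup>+x\<in>S. ennreal (C_norm V * exp (- V x)) * g x \<partial>lborel)"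
    using c
    by (intro nn_integral_mono) (auto split: split_indicator intro!: mult_right_mono mult_left_mono ennreal_leI)
  also have "\<dots> = (\<integral>\<^sup>+x\<in>S. g x \<partial>mu V)"
    using meas by (rule set_nn_integral_mu[symmetric])
  finally show ?thesis .
qed

lemma set_nn_integral_mu_upper:
  assumes meas: "V \<in> borel_measurable borel" "g \<in> borel_measurable borel" "S \<in> sets borel"
    and c: "0 \<le> C_norm V" "\<And>x. x \<in> S \<Longrightarrow> exp (- V x) \<le> c"
  shows "(\<integral>\<^sup>+x\<in>S. g x \<partial>mu V) \<le> ennreal (C_norm V * c) * (\<integral>\<^sup>+x\<in>S. g x \<partial>lborel)"
proof -
  note [measurable] = meas
  have "(\<integral>\<^sup>+x\<in>S. g x \<partial>mu V)
      = (\<integral>\<^sup>+x\<in>S. ennreal (C_norm V * exp (- V x)) * g x \<partial>lborel)"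
    using meas by (rule set_nn_integral_mu)
  also have "\<dots> \<le> (\<integral>\<^sup>+x. ennreal (C_norm V * c) * (g x * indicator S x) \<partial>lborel)"
    using c
    by (intro nn_integral_mono) (auto split: split_indicator intro!: mult_right_mono mult_left_mono ennreal_leI)
  also have "\<dots> = ennreal (C_norm V * c) * (\<integral>\<^sup>+x\<in>S. g x \<partial>lborel)"
    by (intro nn_integral_cmult) simp
  finally show ?thesis .
qed

section \<open>Test functions, truncated energy and far averages\<close>

lemma Cb_infty_continuous: "f \<in> Cb_infty \<Longrightarrow> continuous_on UNIV f"
  unfolding Cb_infty_def
  by (auto dest: spec[of _ "[]"] simp: continuous_on_eq_continuous_at differentiable_imp_continuous_within)

lemma Cb_infty_bounded: "f \<in> Cb_infty \<Longrightarrow> bounded (range f)"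
  unfolding Cb_infty_def by (auto dest: spec[of _ "[]"])

text \<open>This is the inner integral of the middle term of the theorem, in literally the same
  shape, so that it can be folded there.\<close>

definition truncated_energy ::
    "real \<Rightarrow> ('a::euclidean_space \<Rightarrow> real) \<Rightarrow> real \<Rightarrow> 'a \<Rightarrow> ennreal" where
  "truncated_energy \<alpha> f R x = (\<integral>\<^sup>+y\<in>ball 0 R.
      ennreal (jump_density \<alpha> f x y) * indicator {y. norm (x - y) > 1} y \<partial>lborel)"

lemma jump_density_nonneg: "0 \<le> jump_density \<alpha> f x y"
  by (simp add: jump_density_def)

text \<open>The set in the indicator depends on \<open>x\<close>. Written as a case distinction on
  the pair, the integrand is jointly measurable, as Tonelli-type measurability of
  \<open>truncated_energy\<close> requires.\<close>

lemma borel_measurable_truncated_jump: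
  fixes f :: "'a::euclidean_space \<Rightarrow> real"
  assumes [measurable]: "f \<in> borel_measurable borel"
  shows "(\<lambda>(x, y). ennreal (jump_density \<alpha> f x y) * indicator {y. norm (x - y) > 1} y
      * indicator (ball 0 R) y) \<in> borel_measurable (borel \<Otimes>\<^sub>M borel)"
proof -
  have "(\<lambda>(x, y). ennreal (jump_density \<alpha> f x y) * indicator {y. norm (x - y) > 1} y
      * indicator (ball 0 R) y)
      = (\<lambda>p. if 1 < norm (fst p - snd p) \<and> norm (snd p) < R
          then ennreal (jump_density \<alpha> f (fst p) (snd p)) else 0)"
    by (auto simp: fun_eq_iff)
  then show ?thesis
    unfolding jump_density_def by simp
qed

lemma borel_measurable_truncated_energy:
  fixes f :: "'a::euclidean_space \<Rightarrow> real"
  assumes "f \<in> borel_measurable borel"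
  shows "truncated_energy \<alpha> f R \<in> borel_measurable borel"
proof -
  have "sets (borel \<Otimes>\<^sub>M lborel) = sets (borel \<Otimes>\<^sub>M (borel :: 'a measure))"
    by (intro sets_pair_measure_cong) auto
  then show ?thesis
    unfolding truncated_energy_def
    using borel_measurable_truncated_jump[OF assms, of \<alpha> R]
    by (intro lborel.borel_measurable_nn_integral) (simp cong: measurable_cong_sets)
qed

text \<open>
  The average of \<open>f\<close> over a ball lying at distance more than 1 from \<open>x\<close> only involves admissible
  jumps, none of them longer than \<open>2 * r\<close>.
\<close>

lemma far_average_le_truncated_energy:
  fixes f :: "'a::euclidean_space \<Rightarrow> real"
  assumes f: "f \<in> borel_measurable borel" "bounded (range f)"
    and r: "r > 3" and \<alpha>: "0 < \<alpha>"
    and x: "norm x < r" and p: "norm p \<le> 2" "3 / 2 \<le> norm (x - p)"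
  defines "v \<equiv> measure lborel (ball p (1 / 2))"
  defines "c \<equiv> (LINT z:ball p (1 / 2)|lborel. f z) / v"
  shows "ennreal (v * (f x - c)\<^sup>2)
    \<le> ennreal ((2 * r) powr (real DIM('a) + \<alpha>)) * truncated_energy \<alpha> f (r + 1) x"
proof -
  let ?E = "(2 * r) powr (real DIM('a) + \<alpha>)"
  have v: "0 < v"
    unfolding v_def by (simp add: content_ball_pos)
  \<comment> \<open>Jensen's inequality: the square shift with \<open>t = f x\<close>, without its
    variance term.\<close>
  have "ennreal (v * (f x - c)\<^sup>2) \<le> (\<integral>\<^sup>+y\<in>ball p (1 / 2). ennreal ((f y - f x)\<^sup>2) \<partial>lborel)"
    using set_nn_integral_square_shift[of f lborel "ball p (1 / 2)" "f x"] f v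
      emeasure_lborel_ball_finite[of p "1 / 2"]
    by (simp add: power2_commute[of "f x" c] flip: c_def v_def)
  also have "\<dots> \<le> (\<integral>\<^sup>+y. ennreal ?E * (ennreal (jump_density \<alpha> f x y)
      * indicator {y. norm (x - y) > 1} y * indicator (ball 0 (r + 1)) y) \<partial>lborel)"
  proof (intro nn_integral_mono)
    fix y :: 'a
    show "ennreal ((f y - f x)\<^sup>2) * indicator (ball p (1 / 2)) y
      \<le> ennreal ?E * (ennreal (jump_density \<alpha> f x y)
      * indicator {y. norm (x - y) > 1} y * indicator (ball 0 (r + 1)) y)"
    proof (cases "y \<in> ball p (1 / 2)")
      case True
      then have yp: "norm (p - y) < 1 / 2"
        by (simp add: dist_norm)
      \<comment> \<open>The bound \<open>3 / 2\<close> is the jump threshold 1 plus the radius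
        1/2.\<close>
      have far: "norm (x - y) > 1"
        using norm_triangle_ineq[of "x - y" "y - p"] yp p(2) by (simp add: norm_minus_commute)
      \<comment> \<open>This puts \<open>y\<close> in \<open>ball 0 (r + 1)\<close> and bounds the
        jump by \<open>r + 5 / 2\<close>, hence by \<open>2 * r\<close>, since
        \<open>r > 3\<close>.\<close>
      have y: "norm y < 5 / 2"
        using norm_triangle_ineq[of p "y - p"] yp p(1) by (simp add: norm_minus_commute)
      have "norm (x - y) \<le> 2 * r"
        using norm_triangle_ineq4[of x y] x y r by simp
      then have "norm (x - y) powr (real DIM('a) + \<alpha>) \<le> ?E"
        using \<alpha> by (intro powr_mono2) auto
      then have "(f y - f x)\<^sup>2 * norm (x - y) powr (real DIM('a) + \<alpha>) \<le> ?E * (f x - f y)\<^sup>2"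
        by (subst mult.commute, subst power2_commute) (rule mult_right_mono, auto)
      moreover have "0 < norm (x - y) powr (real DIM('a) + \<alpha>)"
        using far by auto
      ultimately have "(f y - f x)\<^sup>2 \<le> ?E * jump_density \<alpha> f x y"
        by (simp only: jump_density_def times_divide_eq_right pos_le_divide_eq)
      then have "ennreal ((f y - f x)\<^sup>2) \<le> ennreal ?E * ennreal (jump_density \<alpha> f x y)"
        by (simp add: ennreal_mult[symmetric] jump_density_nonneg ennreal_leI)
      then show ?thesis
        using True far y r by simp
    qed simp
  qed
  also have "\<dots> = ennreal ?E * truncated_energy \<alpha> f (r + 1) x"
    unfolding truncated_energy_def
    using measurable_Pair2[OF borel_measurable_truncated_jump[OF f(1)], of x]
    by (intro nn_integral_cmult) simp
  finally show ?thesis .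
qed

section \<open>The variance estimate on a ball\<close>

lemma ball_variance_le_truncated_energy:
  fixes V f :: "'a::euclidean_space \<Rightarrow> real"
  assumes \<alpha>: "0 < \<alpha>" and V: "V \<in> borel_measurable borel" "locally_bounded V"
    and int: "integrable lborel (\<lambda>x. exp (- V x))"
    and r: "r > 3" and f: "f \<in> borel_measurable borel" "bounded (range f)"
  defines "v \<equiv> measure lborel (ball (0::'a) (1 / 2))"
    and "u \<equiv> measure lborel (ball (0::'a) 2)"
    and "E \<equiv> (2 * r) powr (real DIM('a) + \<alpha>)"
    and "m \<equiv> (LINT z:ball 0 r|mu V. f z) / measure (mu V) (ball 0 r)"
    and "I \<equiv> (\<integral>\<^sup>+x\<in>ball 0 (r + 1). truncated_energy \<alpha> f (r + 1) x \<partial>mu V)"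
  shows "(\<integral>\<^sup>+x\<in>ball 0 r. ennreal ((f x - m)\<^sup>2) \<partial>mu V)
    \<le> ennreal (2 * E * ((u + v) / v\<^sup>2) * K_sup V r / k_inf V r) * I"
proof -
  note [measurable] = V(1) f(1)
  have [measurable]: "ball q s \<in> sets borel" for q :: 'a and s
    by simp
  have G [measurable]: "truncated_energy \<alpha> f (r + 1) \<in> borel_measurable borel"
    using f(1) by (rule borel_measurable_truncated_energy)
  define C where "C = C_norm V"
  define k where "k = k_inf V r"
  define K where "K = K_sup V r"
  have C: "0 < C"
    unfolding C_def using int by (rule C_norm_pos)
  have k: "0 < k" "k \<le> K"
    using k_inf_pos[OF V(2), of r] k_inf_le_K_sup[OF V(2), of r] r by (auto simp: k_def K_def)
  have v: "0 < v" and u: "0 < u" and E: "0 < E"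
    using r by (auto simp: v_def u_def E_def content_ball_pos)

  \<comment> \<open>A unit vector exists in every dimension; doubling it puts \<open>p\<close> and
    \<open>- p\<close> at distance 4.\<close>
  obtain b :: 'a where b: "b \<in> Basis"
    using nonempty_Basis by blast
  define p where "p = 2 *\<^sub>R b"
  have p: "norm p = 2" "norm (- p) = 2"
    using b by (auto simp: p_def)
  define c where "c = (\<lambda>q. (LINT z:ball q (1 / 2)|lborel. f z) / v)"
  have v_eq: "measure lborel (ball q (1 / 2)) = v" for q :: 'a
    by (simp add: v_def content_ball)
  have far: "ennreal (v * (f x - c q)\<^sup>2) \<le> ennreal E * truncated_energy \<alpha> f (r + 1) x"
    if "norm x < r" "norm q = 2" "3 / 2 \<le> norm (x - q)" for x q
    using far_average_le_truncated_energy[OF f r \<alpha> that(1) _ that(3)] that(2)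
    by (simp add: v_eq c_def E_def)
  \<comment> \<open>A point within 3/2 of \<open>p\<close> has distance at least 4 - 3/2 = 5/2 from
    \<open>- p\<close>.\<close>
  have far_neg: "ennreal (v * (f x - c (- p))\<^sup>2) \<le> ennreal E * truncated_energy \<alpha> f (r + 1) x"
    if "norm x < r" "norm (x - p) < 3 / 2" for x
  proof (rule far[OF that(1) p(2)])
    have "norm (2 *\<^sub>R p) \<le> norm (x + p) + norm (x - p)"
      using norm_triangle_ineq4[of "x + p" "x - p"] by (simp add: scaleR_2)
    then show "3 / 2 \<le> norm (x - - p)"
      using p that(2) by simp
  qed

  define D where "D = (c p - c (- p))\<^sup>2"
  \<comment> \<open>All points of the ball around \<open>p\<close> are far from \<open>- p\<close>.
    Integrating \<open>far_neg\<close> over it controls the difference of the averages, since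
    \<open>c p\<close> is the mean of \<open>f\<close> there.\<close>
  have D: "ennreal (v\<^sup>2 * D * (C * k)) \<le> ennreal E * I"
  proof -
    let ?A = "ball p (1 / 2)"
    have A: "norm x < r" "norm (x - p) < 3 / 2" if "x \<in> ?A" for x
      using that norm_triangle_ineq[of p "x - p"] p r by (auto simp: dist_norm norm_minus_commute)
    have "ennreal (v * D) \<le> (\<integral>\<^sup>+x\<in>?A. ennreal ((f x - c (- p))\<^sup>2) \<partial>lborel)"
      using set_nn_integral_square_shift[of f lborel ?A "c (- p)"] f v
        emeasure_lborel_ball_finite[of p "1 / 2"]
      by (simp add: v_eq D_def c_def)
    then have "ennreal v * ennreal (v * D)
        \<le> ennreal v * (\<integral>\<^sup>+x\<in>?A. ennreal ((f x - c (- p))\<^sup>2) \<partial>lborel)"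
      by (rule mult_left_mono) simp
    also have "\<dots> = (\<integral>\<^sup>+x. ennreal v * (ennreal ((f x - c (- p))\<^sup>2) * indicator ?A x) \<partial>lborel)"
      by (intro nn_integral_cmult[symmetric]) measurable
    also have "\<dots> \<le> (\<integral>\<^sup>+x. ennreal E * (truncated_energy \<alpha> f (r + 1) x * indicator ?A x) \<partial>lborel)"
    proof (intro nn_integral_mono)
      fix x
      show "ennreal v * (ennreal ((f x - c (- p))\<^sup>2) * indicator ?A x)
        \<le> ennreal E * (truncated_energy \<alpha> f (r + 1) x * indicator ?A x)"
        using far_neg[OF A, of x] v by (cases "x \<in> ?A") (simp_all add: ennreal_mult)
    qed
    also have "\<dots> = ennreal E * (\<integral>\<^sup>+x\<in>?A. truncated_energy \<alpha> f (r + 1) x \<partial>lborel)"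
      by (intro nn_integral_cmult) simp
    finally have le: "ennreal (v\<^sup>2 * D)
        \<le> ennreal E * (\<integral>\<^sup>+x\<in>?A. truncated_energy \<alpha> f (r + 1) x \<partial>lborel)"
      using v by (simp add: D_def ennreal_mult[symmetric] power2_eq_square mult.assoc)
    \<comment> \<open>Return from Lebesgue measure to \<open>mu V\<close>: the density is at least
      \<open>C * k\<close> on this ball.\<close>
    have "ennreal (C * k) * (\<integral>\<^sup>+x\<in>?A. truncated_energy \<alpha> f (r + 1) x \<partial>lborel)
        \<le> (\<integral>\<^sup>+x\<in>?A. truncated_energy \<alpha> f (r + 1) x \<partial>mu V)"
      unfolding C_def k_def
    proof (intro set_nn_integral_mu_lower V G)
      show "0 \<le> C_norm V"
        using C by (simp add: C_def)
      show "k_inf V r \<le> exp (- V x)" if "x \<in> ?A" for x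
        using A[OF that] r by (intro k_inf_le V) auto
    qed simp
    also have "\<dots> \<le> I"
      unfolding I_def using A r
      by (intro nn_integral_mono) (fastforce split: split_indicator)
    finally have I: "ennreal (C * k) * (\<integral>\<^sup>+x\<in>?A. truncated_energy \<alpha> f (r + 1) x \<partial>lborel) \<le> I" .
    have "ennreal (v\<^sup>2 * D * (C * k)) = ennreal (C * k) * ennreal (v\<^sup>2 * D)"
      using C k by (simp add: D_def ennreal_mult[symmetric] mult.commute)
    also have "\<dots> \<le> ennreal (C * k)
        * (ennreal E * (\<integral>\<^sup>+x\<in>?A. truncated_energy \<alpha> f (r + 1) x \<partial>lborel))"
      using le by (rule mult_left_mono) simp
    also have "\<dots> = ennreal E
        * (ennreal (C * k) * (\<integral>\<^sup>+x\<in>?A. truncated_energy \<alpha> f (r + 1) x \<partial>lborel))"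
      by (rule mult.left_commute)
    also have "\<dots> \<le> ennreal E * I"
      using I by (rule mult_left_mono) simp
    finally show ?thesis .
  qed

  \<comment> \<open>\<open>?N\<close> contains every point of \<open>?B\<close> within 3/2 of
    \<open>p\<close>, the only points that need the detour through \<open>c (- p)\<close>.
    Intersecting with \<open>?B\<close> keeps it where \<open>K_sup V r\<close> bounds the
    weight.\<close>
  let ?B = "ball (0::'a) r" and ?N = "ball (0::'a) r \<inter> ball p 2"
  let ?J = "\<integral>\<^sup>+x\<in>?B. ennreal ((f x - c p)\<^sup>2) \<partial>mu V"
  have emeasure_le: "emeasure (mu V) S \<le> ennreal (C * K) * emeasure lborel S"
    if "S \<in> sets borel" "S \<subseteq> ?B" for S
  proof -
    have "(\<integral>\<^sup>+x\<in>S. 1 \<partial>mu V) \<le> ennreal (C_norm V * K_sup V r) * (\<integral>\<^sup>+x\<in>S. 1 \<partial>lborel)"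
    proof (intro set_nn_integral_mu_upper V that)
      show "0 \<le> C_norm V"
        using C by (simp add: C_def)
      show "exp (- V x) \<le> K_sup V r" if "x \<in> S" for x
        using \<open>S \<subseteq> ?B\<close> that r by (intro le_K_sup V) auto
    qed simp
    then show ?thesis
      using that by (simp add: C_def K_def)
  qed
  have B_finite: "emeasure (mu V) ?B < \<infinity>"
    using emeasure_le[of ?B] emeasure_lborel_ball_finite[of "0::'a" r]
    by (auto simp: ennreal_mult_less_top elim!: order.strict_trans1)
  have N: "emeasure (mu V) ?N \<le> ennreal (C * K * u)"
  proof -
    have "emeasure (mu V) ?N \<le> ennreal (C * K) * emeasure lborel (ball p 2)"
      by (rule order_trans[OF emeasure_le]) (auto intro!: mult_left_mono emeasure_mono)
    also have "emeasure lborel (ball p 2) = ennreal u"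
      using emeasure_lborel_ball_finite[of p 2]
      by (simp add: emeasure_eq_ennreal_measure u_def content_ball)
    finally show ?thesis
      using C k u by (simp add: ennreal_mult)
  qed
  \<comment> \<open>With \<open>B_finite\<close>, this makes \<open>m\<close> a true mean, not a
    quotient by zero.\<close>
  have B_pos: "0 < measure (mu V) ?B"
  proof -
    have "ennreal (C_norm V * k_inf V r) * (\<integral>\<^sup>+x\<in>?B. 1 \<partial>lborel) \<le> (\<integral>\<^sup>+x\<in>?B. 1 \<partial>mu V)"
    proof (intro set_nn_integral_mu_lower V)
      show "0 \<le> C_norm V"
        using C by (simp add: C_def)
      show "k_inf V r \<le> exp (- V x)" if "x \<in> ?B" for x
        using that r by (intro k_inf_le V) auto
    qed auto
    then have "ennreal (C * k) * emeasure lborel ?B \<le> emeasure (mu V) ?B"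
      by (simp add: C_def k_def)
    moreover have "0 < ennreal (C * k) * emeasure lborel ?B"
      using C k r content_ball_pos[of r "0::'a"]
      by (auto simp: ennreal_zero_less_mult_iff measure_def zero_less_iff_neq_zero)
    ultimately have "0 < emeasure (mu V) ?B"
      by (rule order.strict_trans2[rotated])
    then show ?thesis
      using B_finite by (simp add: measure_def enn2real_positive_iff)
  qed

  \<comment> \<open>The mean \<open>m\<close> minimises the mean square deviation, so any constant,
    here \<open>c p\<close>, may replace it.\<close>
  have variance_le: "(\<integral>\<^sup>+x\<in>?B. ennreal ((f x - m)\<^sup>2) \<partial>mu V) \<le> ?J"
    using set_nn_integral_square_shift[of f "mu V" ?B "c p"] f B_finite B_pos
    by (simp add: m_def)
  have "ennreal (v\<^sup>2 * k) * ?J \<le> ennreal (2 * E * K * (u + v)) * I"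
  proof -
    have "ennreal v * ?J = (\<integral>\<^sup>+x. ennreal v * (ennreal ((f x - c p)\<^sup>2) * indicator ?B x) \<partial>mu V)"
      by (intro nn_integral_cmult[symmetric]) simp
    \<comment> \<open>Pointwise estimate: far points cost one energy term, points near
      \<open>p\<close> cost twice the energy plus \<open>2 * v * D\<close>. The latter is charged to
      \<open>?N\<close> only.\<close>
    also have "\<dots> \<le> (\<integral>\<^sup>+x. ennreal (2 * E) * (truncated_energy \<alpha> f (r + 1) x * indicator (ball 0 (r + 1)) x)
        + ennreal (2 * v * D) * indicator ?N x \<partial>mu V)"
    proof (intro nn_integral_mono)
      fix x
      let ?G = "truncated_energy \<alpha> f (r + 1) x"
      have two: "ennreal (2 * E) * ?G = 2 * (ennreal E * ?G)"
        using E by (simp add: ennreal_mult mult.assoc)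
      show "ennreal v * (ennreal ((f x - c p)\<^sup>2) * indicator ?B x)
        \<le> ennreal (2 * E) * (?G * indicator (ball 0 (r + 1)) x) + ennreal (2 * v * D) * indicator ?N x"
      proof (cases "x \<in> ?B")
        case x: True
        show ?thesis
        proof (cases "norm (x - p) < 3 / 2")
          case True
          \<comment> \<open>With A = \<open>f x - c (- p)\<close> and B =
            \<open>c (- p) - c p\<close>, this is 2 A^2 + 2 B^2 - (A + B)^2 = (A - B)^2, which is
            nonnegative.\<close>
          have "(f x - c p)\<^sup>2 \<le> 2 * (f x - c (- p))\<^sup>2 + 2 * D"
            using sum_squares_ge_zero[of "f x - c (- p) + (c p - c (- p))" 0]
            by (simp add: D_def power2_eq_square algebra_simps)
          then have "v * (f x - c p)\<^sup>2 \<le> v * (2 * (f x - c (- p))\<^sup>2 + 2 * D)"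
            using v by (intro mult_left_mono) auto
          then have "ennreal (v * (f x - c p)\<^sup>2)
              \<le> ennreal (2 * (v * (f x - c (- p))\<^sup>2) + 2 * v * D)"
            by (intro ennreal_leI) (simp add: algebra_simps)
          also have "\<dots> = 2 * ennreal (v * (f x - c (- p))\<^sup>2) + ennreal (2 * v * D)"
            using v by (simp add: D_def ennreal_plus ennreal_mult)
          also have "\<dots> \<le> 2 * (ennreal E * ?G) + ennreal (2 * v * D)"
            using x True by (intro add_right_mono mult_left_mono far_neg) auto
          finally show ?thesis
            using x True v by (simp add: two ennreal_mult dist_norm norm_minus_commute)
        next
          case False
          then have "ennreal (v * (f x - c p)\<^sup>2) \<le> ennreal E * ?G"
            using x p by (intro far) auto
          also have "\<dots> \<le> 2 * (ennreal E * ?G)"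
            using mult_right_mono[of 1 2 "ennreal E * ?G"] by simp
          also have "\<dots> \<le> 2 * (ennreal E * ?G) + ennreal (2 * v * D) * indicator ?N x"
            by simp
          finally show ?thesis
            using x v by (simp add: two ennreal_mult)
        qed
      qed simp
    qed
    also have "\<dots> = ennreal (2 * E) * I + ennreal (2 * v * D) * emeasure (mu V) ?N"
      unfolding I_def by (subst nn_integral_add) (auto simp: nn_integral_cmult)
    also have "\<dots> \<le> ennreal (2 * E) * I + ennreal (2 * v * D) * ennreal (C * K * u)"
      using N by (intro add_left_mono mult_left_mono) auto
    finally have "ennreal (v * k) * (ennreal v * ?J)
        \<le> ennreal (v * k) * (ennreal (2 * E) * I + ennreal (2 * v * D) * ennreal (C * K * u))"
      by (rule mult_left_mono) simp
    \<comment> \<open>The factor \<open>C\<close> from the mass of \<open>?N\<close> is regrouped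
      with \<open>k\<close> to match the left side of \<open>D\<close>, so the normalisation
      cancels. The first summand then only needs \<open>k\<close> raised to \<open>K\<close>;
      together they give \<open>u + v\<close>.\<close>
    also have "\<dots> = ennreal (2 * E * v * k) * I + ennreal (2 * K * u) * ennreal (v\<^sup>2 * D * (C * k))"
      using v k C u E
      by (simp add: D_def distrib_left mult.assoc[symmetric] ennreal_mult[symmetric])
        (simp add: power2_eq_square ac_simps)
    also have "\<dots> \<le> ennreal (2 * E * v * K) * I + ennreal (2 * K * u) * (ennreal E * I)"
      using D k v E by (intro add_mono mult_left_mono mult_right_mono ennreal_leI) auto
    also have "\<dots> = ennreal (2 * E * K * (u + v)) * I"
      using k v u E
      by (simp add: mult.assoc[symmetric] ennreal_mult[symmetric] ennreal_plus[symmetric]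
          distrib_right[symmetric] del: ennreal_plus) (simp add: algebra_simps)
    finally show ?thesis
      using v k by (simp add: mult.assoc[symmetric] ennreal_mult[symmetric])
        (simp add: power2_eq_square ac_simps)
  qed
  then have "?J \<le> ennreal (2 * E * K * (u + v) / (v\<^sup>2 * k)) * I"
    using v k u E by (intro ennreal_le_divide_if_mult_le) auto
  with variance_le have "(\<integral>\<^sup>+x\<in>?B. ennreal ((f x - m)\<^sup>2) \<partial>mu V)
      \<le> ennreal (2 * E * K * (u + v) / (v\<^sup>2 * k)) * I"
    by (rule order_trans)
  then show ?thesis
    by (simp add: K_def k_def ac_simps)
qed

section \<open>Passage to the full form and choice of the constant\<close>

text \<open>Removing both restrictions to the ball enlarges the nonnegative integrals; the factor 2
  cancels the 1/2 in \<open>D_form\<close>.\<close>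

lemma truncated_form_le_D_form:
  "(\<integral>\<^sup>+x\<in>ball 0 R. truncated_energy \<alpha> f R x \<partial>mu V) \<le> 2 * D_form \<alpha> V f"
proof -
  have "2 * D_form \<alpha> V f
      = (\<integral>\<^sup>+x. (\<integral>\<^sup>+y\<in>{y. norm (x - y) > 1}. ennreal (jump_density \<alpha> f x y) \<partial>lborel) \<partial>mu V)"
    by (simp add: D_form_def mult.commute[of 2] ennreal_divide_times mult_divide_eq_ennreal)
  moreover have "truncated_energy \<alpha> f R x * indicator (ball 0 R) x
      \<le> (\<integral>\<^sup>+y\<in>{y. norm (x - y) > 1}. ennreal (jump_density \<alpha> f x y) \<partial>lborel)" for x
    unfolding truncated_energy_def
    by (auto split: split_indicator intro!: nn_integral_mono)
  ultimately show ?thesis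
    by (simp add: nn_integral_mono)
qed

theorem proposition2p4:
  fixes V :: "'a::euclidean_space \<Rightarrow> real" and \<alpha> :: real
  assumes "0 < \<alpha>" and "\<alpha> < 2"
    and "V \<in> borel_measurable borel"
    and "locally_bounded V"
    and "integrable lborel (\<lambda>x. exp (- V x))"
  shows "\<exists>C4::real. C4 > 0 \<and> (\<forall>r f. r > 3 \<longrightarrow> f \<in> Cb_infty \<longrightarrow>
    (\<integral>\<^sup>+x\<in>ball 0 r. ennreal ((f x - (LINT z:ball 0 r|mu V. f z) / measure (mu V) (ball 0 r))\<^sup>2) \<partial>mu V)
      \<le> ennreal (C4 * K_sup V r * r powr (2 * real DIM('a) + \<alpha>) / k_inf V r)
         * (\<integral>\<^sup>+x\<in>ball 0 (r + 1). (\<integral>\<^sup>+y\<in>ball 0 (r + 1).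
              ennreal (jump_density \<alpha> f x y) * indicator {y. norm (x - y) > 1} y \<partial>lborel) \<partial>mu V)
    \<and> ennreal (C4 * K_sup V r * r powr (2 * real DIM('a) + \<alpha>) / k_inf V r)
         * (\<integral>\<^sup>+x\<in>ball 0 (r + 1). (\<integral>\<^sup>+y\<in>ball 0 (r + 1).
              ennreal (jump_density \<alpha> f x y) * indicator {y. norm (x - y) > 1} y \<partial>lborel) \<partial>mu V)
      \<le> ennreal (2 * C4 * K_sup V r * r powr (2 * real DIM('a) + \<alpha>) / k_inf V r) * D_form \<alpha> V f)"
proof -
  define v where "v = measure lborel (ball (0::'a) (1 / 2))"
  define u where "u = measure lborel (ball (0::'a) 2)"
  \<comment> \<open>The power of 2 is split off from
    \<open>(2 * r) powr (real DIM('a) + \<alpha>)\<close>; the remaining factors depend on the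
    dimension only.\<close>
  define a where "a = 2 * 2 powr (real DIM('a) + \<alpha>) * ((u + v) / v\<^sup>2)"
  have "0 < v" "0 < u"
    by (auto simp: v_def u_def content_ball_pos)
  then have a: "0 < a"
    by (simp add: a_def)
  show ?thesis
    unfolding truncated_energy_def[symmetric]
  proof (intro exI[of _ a] conjI allI impI a)
    fix r :: real and f :: "'a \<Rightarrow> real"
    assume r: "r > 3" and f: "f \<in> Cb_infty"
    let ?I = "\<integral>\<^sup>+x\<in>ball 0 (r + 1). truncated_energy \<alpha> f (r + 1) x \<partial>mu V"
    let ?m = "(LINT z:ball 0 r|mu V. f z) / measure (mu V) (ball 0 r)"
    let ?c = "a * K_sup V r * r powr (2 * real DIM('a) + \<alpha>) / k_inf V r"
    have k: "0 < k_inf V r" "0 < K_sup V r"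
      using k_inf_pos[OF assms(4), of r] k_inf_le_K_sup[OF assms(4), of r] r by auto
    have "(\<integral>\<^sup>+x\<in>ball 0 r. ennreal ((f x - ?m)\<^sup>2) \<partial>mu V)
        \<le> ennreal (2 * (2 * r) powr (real DIM('a) + \<alpha>) * ((u + v) / v\<^sup>2) * K_sup V r / k_inf V r) * ?I"
      unfolding u_def v_def
      using borel_measurable_continuous_onI[OF Cb_infty_continuous[OF f]] Cb_infty_bounded[OF f] assms r
      by (intro ball_variance_le_truncated_energy) auto
    also have "2 * (2 * r) powr (real DIM('a) + \<alpha>) * ((u + v) / v\<^sup>2) * K_sup V r / k_inf V r
        = a * K_sup V r * r powr (real DIM('a) + \<alpha>) / k_inf V r"
      using r by (simp add: a_def powr_mult)
    \<comment> \<open>The estimate so far has the exponent d + \<alpha>; as r > 1, it may be raised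
      to 2d + \<alpha>.\<close>
    also have "ennreal \<dots> * ?I \<le> ennreal ?c * ?I"
      using a k r
      by (intro mult_right_mono ennreal_leI divide_right_mono mult_left_mono powr_mono) auto
    finally show "(\<integral>\<^sup>+x\<in>ball 0 r. ennreal ((f x - ?m)\<^sup>2) \<partial>mu V) \<le> ennreal ?c * ?I" .
    have "ennreal ?c * ?I \<le> ennreal ?c * (2 * D_form \<alpha> V f)"
      by (intro mult_left_mono truncated_form_le_D_form) simp
    also have "\<dots> = ennreal (2 * a * K_sup V r * r powr (2 * real DIM('a) + \<alpha>) / k_inf V r)
        * D_form \<alpha> V f"
    proof -
      have "ennreal (2 * ?c) = ennreal ?c * 2"
        using a k by (subst mult.commute) (subst ennreal_mult; simp)
      then show ?thesis
        by (simp add: mult.assoc)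
    qed
    finally show "ennreal ?c * ?I
        \<le> ennreal (2 * a * K_sup V r * r powr (2 * real DIM('a) + \<alpha>) / k_inf V r) * D_form \<alpha> V f" .
  qed
qed

end
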